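(* Let $d$ be a positive integer and let $C$ be a configuration of pebbles on the $d$-dimensional hypercube $Q^d$ with $|C|\ge 3^d-|\sigma(C)|+1$. Then $C$ is coverable.
   Context: The $d$-dimensional hypercube $Q^d$ has vertex set $\{0,1\}^d$, two vertices being adjacent iff they differ in exactly one coordinate. A configuration of pebbles on $Q^d$ is a function $C:V(Q^d)\to\{0,1,2,\ldots\}$; its size is $|C|=\sum_{x}C(x)$ and its support is $\sigma(C)=\{x: C(x)>0\}$. A pebbling step removes two pebbles from one vertex and places one pebble on an adjacent vertex. $C$ is coverable if after some sequence of pebbling steps no vertex has zero pebbles. (The paper calls configurations satisfying the size hypothesis "good".) *)

theory Defs
  imports Main
begin

text \<open>The vertex set \<open>{0,1}\<^sup>d\<close> is encoded by the Boolean lists of length \<open>d\<close>.\<close>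

definition cube_verts :: "nat \<Rightarrow> bool list set" where
  "cube_verts d = {x. length x = d}"

definition cube_adj :: "nat \<Rightarrow> bool list \<Rightarrow> bool list \<Rightarrow> bool" where
  "cube_adj d x y \<longleftrightarrow>
     x \<in> cube_verts d \<and> y \<in> cube_verts d \<and> card {i. i < d \<and> x ! i \<noteq> y ! i} = 1"

text \<open>
  A configuration on the \<open>d\<close>-cube is a total function on Boolean lists of which only the values
  on \<^term>\<open>cube_verts d\<close> matter: every notion below is restricted to these vertices.
\<close>

type_synonym config = "bool list \<Rightarrow> nat"

definition config_size :: "nat \<Rightarrow> config \<Rightarrow> nat" where
  "config_size d C = (\<Sum>x\<in>cube_verts d. C x)"

definition config_support :: "nat \<Rightarrow> config \<Rightarrow> bool list set" where
  "config_support d C = {x \<in> cube_verts d. C x > 0}"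

definition pebbling_step :: "nat \<Rightarrow> config \<Rightarrow> config \<Rightarrow> bool" where
  "pebbling_step d C C' \<longleftrightarrow>
     (\<exists>x y. cube_adj d x y \<and> C x \<ge> 2 \<and> C' = C(x := C x - 2, y := C y + 1))"

definition coverable :: "nat \<Rightarrow> config \<Rightarrow> bool" where
  "coverable d C \<longleftrightarrow>
     (\<exists>C'. (pebbling_step d)\<^sup>*\<^sup>* C C' \<and> (\<forall>x\<in>cube_verts d. C' x \<noteq> 0))"

lemma finite_cube_verts: "finite (cube_verts d)"
  using finite_lists_length_eq[of "UNIV :: bool set" d] by (simp add: cube_verts_def)

end

theory Submission
  imports Defs
begin

text \<open>
  Give a pile of \<open>n > 0\<close> pebbles weight \<open>n + 1\<close>, so that the hypothesis says that the total weight
  exceeds \<open>3\<^sup>d\<close>, and induct on \<open>d\<close>. Write \<open>N = 3\<^sup>d\<close> and split the \<open>(d+1)\<close>-cube into two halves of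
  weights \<open>w\<^sub>0 \<ge> w\<^sub>1\<close> with \<open>w\<^sub>0 + w\<^sub>1 > 3N\<close>. If \<open>w\<^sub>1 \<le> N\<close>, pebbles are moved across to the lighter
  half. A move from a pile of at least three pebbles lowers \<open>w\<^sub>0\<close> by two and raises \<open>w\<^sub>1\<close> by one or
  two, hence does not lower the potential \<open>w\<^sub>0 + 2 w\<^sub>1\<close>. If the potential is at least \<open>3N + 4\<close>, then
  \<open>w\<^sub>0 \<ge> N + 4 > 3 \<sqdot> 2\<^sup>d\<close> as long as \<open>w\<^sub>1 \<le> N\<close>, so a pile of three always exists and eventually both
  weights exceed \<open>N\<close>. Potential \<open>3N + 3\<close> suffices when at most one pile of the heavy half has more
  than one pebble. Only \<open>w\<^sub>1 \<in> {0, 2}\<close> needs care: one move reduces \<open>w\<^sub>1 = 0\<close> to \<open>w\<^sub>1 = 2\<close>, a single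
  pebble; then either some pile of two or more can be moved to an empty vertex, which raises the
  potential to \<open>3N + 4\<close>, or only one pile of the heavy half has more than one pebble.
\<close>

section \<open>Weights and counting bounds\<close>

definition pile_weight :: "nat \<Rightarrow> nat" where
  "pile_weight n = (if n = 0 then 0 else Suc n)"

definition weight :: "nat \<Rightarrow> config \<Rightarrow> nat" where
  "weight d C = (\<Sum>x\<in>cube_verts d. pile_weight (C x))"

definition half :: "bool \<Rightarrow> config \<Rightarrow> config" where
  "half b C x = C (b # x)"

definition cross :: "bool \<Rightarrow> bool list \<Rightarrow> config \<Rightarrow> config" where
  "cross b x C = C(b # x := C (b # x) - 2, (\<not> b) # x := C ((\<not> b) # x) + 1)"

lemma weight_eq_size_plus_support:
  "weight d C = config_size d C + card (config_support d C)"
proof -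
  have "card (config_support d C) = (\<Sum>x\<in>cube_verts d. if C x > 0 then 1 else 0)"
    unfolding config_support_def
    by (simp add: sum.If_cases finite_cube_verts Int_def)
  then show ?thesis
    by (auto simp: weight_def config_size_def pile_weight_def sum.distrib[symmetric] intro!: sum.cong)
qed

text \<open>The additive form keeps truncated subtraction out of later weight computations.\<close>

lemma weight_update:
  assumes "x \<in> cube_verts d"
  shows "weight d (C(x := n)) + pile_weight (C x) = weight d C + pile_weight n"
proof -
  have "(\<Sum>y\<in>cube_verts d - {x}. pile_weight ((C(x := n)) y))
      = (\<Sum>y\<in>cube_verts d - {x}. pile_weight (C y))"
    by (rule sum.cong) auto
  then show ?thesis
    using assms by (simp add: weight_def sum.remove[OF finite_cube_verts])
qed

lemma cube_verts_Suc:
  "cube_verts (Suc d) = (#) b ` cube_verts d \<union> (#) (\<not> b) ` cube_verts d"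
proof (rule set_eqI)
  show "z \<in> cube_verts (Suc d) \<longleftrightarrow> z \<in> (#) b ` cube_verts d \<union> (#) (\<not> b) ` cube_verts d" for z
    by (cases z) (auto simp: cube_verts_def)
qed

lemma weight_Suc: "weight (Suc d) C = weight d (half b C) + weight d (half (\<not> b) C)"
  unfolding weight_def cube_verts_Suc[of d b]
  by (subst sum.union_disjoint)
     (auto simp: finite_cube_verts sum.reindex half_def)

lemma card_cube_verts: "card (cube_verts d) = 2 ^ d"
  using card_lists_length_eq[of "UNIV :: bool set" d] by (simp add: cube_verts_def)

text \<open>Pigeonhole: a pile of at most two weighs at most 3, and there are \<open>2 ^ d\<close>
  vertices.\<close>

lemma exists_pile_ge_3:
  assumes "3 * 2 ^ d < weight d C"
  obtains x where "x \<in> cube_verts d" "3 \<le> C x"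
proof -
  have "\<exists>x\<in>cube_verts d. 3 \<le> C x"
  proof (rule ccontr)
    assume "\<not> ?thesis"
    then have "weight d C \<le> (\<Sum>x\<in>cube_verts d. 3)"
      unfolding weight_def by (intro sum_mono) (force simp: pile_weight_def)
    then show False
      using assms by (simp add: card_cube_verts)
  qed
  then show ?thesis
    using that by blast
qed

text \<open>Without a pile of three, each vertex weighs at most 2, except that \<open>a\<close> may
  weigh 3.\<close>

lemma exists_pile_ge_3_single_stack:
  assumes "2 * 2 ^ d + 1 < weight d C"
    and "\<forall>x\<in>cube_verts d. x \<noteq> a \<longrightarrow> C x \<le> 1"
  shows "a \<in> cube_verts d \<and> 3 \<le> C a"
proof (rule ccontr)
  assume "\<not> ?thesis"
  then have "weight d C \<le> (\<Sum>x\<in>cube_verts d. 2 + (if x = a then 1 else 0))"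
    unfolding weight_def using assms(2)
    by (intro sum_mono) (force simp: pile_weight_def)
  also have "\<dots> \<le> 2 * 2 ^ d + 1"
    unfolding sum.distrib by (simp add: card_cube_verts finite_cube_verts)
  finally show False
    using assms(1) by simp
qed

lemma pow2_le_pow3: "2 * 2 ^ d \<le> 3 ^ d + (1 :: nat)"
proof (induction d)
  case (Suc d)
  moreover have "(1 :: nat) \<le> 3 ^ d"
    by simp
  ultimately show ?case
    unfolding power_Suc by linarith
qed simp

lemma three_pow2_le_pow3: "3 * 2 ^ d \<le> 3 ^ d + (3 :: nat)"
proof (induction d)
  case IH: (Suc d)
  show ?case
  \<comment> \<open>The inductive estimate needs \<open>3 ^ d \<ge> 3\<close>, so the step from 0 to
    1, where equality holds, is checked directly.\<close>
  proof (cases d)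
    case (Suc n)
    moreover have "(1 :: nat) \<le> 3 ^ n"
      by simp
    ultimately show ?thesis
      using IH unfolding Suc power_Suc by linarith
  qed simp
qed simp

text \<open>Every occupied vertex weighs at least 2, so a second one would bring the weight to
  4.\<close>

lemma weight_2_imp_single_support:
  assumes "weight d C = 2"
  obtains a where "a \<in> cube_verts d" "\<And>x. x \<in> cube_verts d \<Longrightarrow> x \<noteq> a \<Longrightarrow> C x = 0"
proof -
  from assms obtain a where a: "a \<in> cube_verts d" "C a \<noteq> 0"
    unfolding weight_def by (metis (mono_tags, lifting) pile_weight_def sum.neutral zero_neq_numeral)
  have "C x = 0" if "x \<in> cube_verts d" "x \<noteq> a" for x
  proof (rule ccontr)
    assume "C x \<noteq> 0"
    have "(\<Sum>y\<in>{a, x}. pile_weight (C y)) \<le> weight d C"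
      unfolding weight_def using a that by (intro sum_mono2 finite_cube_verts) auto
    then show False
      using assms a that \<open>C x \<noteq> 0\<close> by (simp add: pile_weight_def)
  qed
  then show ?thesis
    using that a(1) by blast
qed

section \<open>Pebbling moves within and between the two halves\<close>

lemma cube_adj_Cons: "cube_adj d x y \<Longrightarrow> cube_adj (Suc d) (b # x) (b # y)"
proof -
  assume *: "cube_adj d x y"
  have "{i. i < Suc d \<and> (b # x) ! i \<noteq> (b # y) ! i} = Suc ` {i. i < d \<and> x ! i \<noteq> y ! i}"
    by (auto simp: less_Suc_eq_0_disj)
  then show ?thesis
    using * by (simp add: cube_adj_def cube_verts_def card_image)
qed

lemma cube_adj_flip:
  assumes "x \<in> cube_verts d"
  shows "cube_adj (Suc d) (b # x) ((\<not> b) # x)"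
proof -
  have "{i. i < Suc d \<and> (b # x) ! i \<noteq> ((\<not> b) # x) ! i} = {0}"
    by (auto simp: nth_Cons')
  then show ?thesis
    using assms by (simp add: cube_adj_def cube_verts_def)
qed

lemma half_update [simp]:
  "half b (C(b # x := n)) = (half b C)(x := n)"
  "half (\<not> b) (C(b # x := n)) = half (\<not> b) C"
  "half b (C((\<not> b) # x := n)) = half b C"
  by (auto simp: half_def)

text \<open>Moves inside one half lift to the whole cube without touching the other half, so the
  halves can be covered one after the other.\<close>

lemma pebbling_steps_half:
  assumes "(pebbling_step d)\<^sup>*\<^sup>* (half b C) D"
  obtains C' where "(pebbling_step (Suc d))\<^sup>*\<^sup>* C C'" "half b C' = D" "half (\<not> b) C' = half (\<not> b) C"
proof -
  from assms have "\<exists>C'. (pebbling_step (Suc d))\<^sup>*\<^sup>* C C' \<and> half b C' = D \<and> half (\<not> b) C' = half (\<not> b) C"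
  proof (induction rule: rtranclp_induct)
    case base
    then show ?case by blast
  next
    case (step D E)
    then obtain C' where C': "(pebbling_step (Suc d))\<^sup>*\<^sup>* C C'" "half b C' = D"
      "half (\<not> b) C' = half (\<not> b) C" by blast
    obtain x y where xy: "cube_adj d x y" "2 \<le> D x" "E = D(x := D x - 2, y := D y + 1)"
      using step.hyps by (auto simp: pebbling_step_def)
    let ?C = "C'(b # x := C' (b # x) - 2, b # y := C' (b # y) + 1)"
    have "pebbling_step (Suc d) C' ?C"
      unfolding pebbling_step_def using cube_adj_Cons[OF xy(1)] xy(2) C'(2)
      by (intro exI[of _ "b # x"] exI[of _ "b # y"]) (auto simp: half_def)
    moreover have "half b ?C = E" "half (\<not> b) ?C = half (\<not> b) C"
      using xy C' by (auto simp: half_def)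
    ultimately show ?case
      using rtranclp.rtrancl_into_rtrancl[OF C'(1)] by blast
  qed
  then show ?thesis
    using that by blast
qed

lemma coverable_halves:
  assumes "coverable d (half b C)" "coverable d (half (\<not> b) C)"
  shows "coverable (Suc d) C"
proof -
  obtain D where D: "(pebbling_step d)\<^sup>*\<^sup>* (half b C) D" "\<forall>x\<in>cube_verts d. D x \<noteq> 0"
    using assms(1) by (auto simp: coverable_def)
  obtain E where E: "(pebbling_step d)\<^sup>*\<^sup>* (half (\<not> b) C) E" "\<forall>x\<in>cube_verts d. E x \<noteq> 0"
    using assms(2) by (auto simp: coverable_def)
  obtain C1 where C1: "(pebbling_step (Suc d))\<^sup>*\<^sup>* C C1" "half b C1 = D"
    "half (\<not> b) C1 = half (\<not> b) C"
    using pebbling_steps_half[OF D(1)] .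
  obtain C2 where C2: "(pebbling_step (Suc d))\<^sup>*\<^sup>* C1 C2" "half (\<not> b) C2 = E"
    "half (\<not> \<not> b) C2 = half (\<not> \<not> b) C1"
    using pebbling_steps_half[of d "\<not> b" C1 E] E(1) C1(3) by metis
  have "C2 (b # x) = D x" "C2 ((\<not> b) # x) = E x" for x
    using C1(2) C2(2,3) by (auto simp: half_def fun_eq_iff)
  then have "\<forall>z\<in>cube_verts (Suc d). C2 z \<noteq> 0"
    using D(2) E(2) unfolding cube_verts_Suc[of d b] by auto
  then show ?thesis
    unfolding coverable_def using C1(1) C2(1) by (meson rtranclp_trans)
qed

lemma coverable_cross:
  assumes "x \<in> cube_verts d" "2 \<le> half b C x" "coverable (Suc d) (cross b x C)"
  shows "coverable (Suc d) C"
proof -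
  have "pebbling_step (Suc d) C (cross b x C)"
    unfolding pebbling_step_def cross_def
    using cube_adj_flip[OF assms(1), of b] assms(2) by (auto simp: half_def)
  then show ?thesis
    using assms(3) unfolding coverable_def by (meson converse_rtranclp_into_rtranclp)
qed

lemma half_cross:
  "half b (cross b x C) = (half b C)(x := half b C x - 2)"
  "half (\<not> b) (cross b x C) = (half (\<not> b) C)(x := half (\<not> b) C x + 1)"
  by (auto simp: half_def cross_def)

text \<open>Emptying a pile of exactly two also loses an occupied vertex, whence 3 instead of
  2.\<close>

lemma weight_cross_source:
  assumes "x \<in> cube_verts d" "2 \<le> half b C x"
  shows "weight d (half b C) = weight d (half b (cross b x C)) + (if half b C x = 2 then 3 else 2)"
  using weight_update[OF assms(1), of "half b C" "half b C x - 2"] assms(2)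
  by (auto simp: half_cross pile_weight_def split: if_splits)

lemma weight_cross_target:
  assumes "x \<in> cube_verts d"
  shows "weight d (half (\<not> b) (cross b x C))
    = weight d (half (\<not> b) C) + (if half (\<not> b) C x = 0 then 2 else 1)"
  using weight_update[OF assms, of "half (\<not> b) C" "half (\<not> b) C x + 1"]
  by (auto simp: half_cross pile_weight_def split: if_splits)

section \<open>The induction step\<close>

context
  fixes d :: nat
  assumes heavy_coverable: "\<And>C. 3 ^ d < weight d C \<Longrightarrow> coverable d C"
begin

lemma coverable_of_potential:
  assumes "3 ^ d < weight d (half b C)"
    and "3 * 3 ^ d + 4 \<le> weight d (half b C) + 2 * weight d (half (\<not> b) C) \<or>
      3 * 3 ^ d + 3 \<le> weight d (half b C) + 2 * weight d (half (\<not> b) C) \<and>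
      (\<exists>a. \<forall>x\<in>cube_verts d. x \<noteq> a \<longrightarrow> half b C x \<le> 1)"
  shows "coverable (Suc d) C"
  using assms
\<comment> \<open>The measure is what the lighter half still lacks to exceed N; every move across
  reduces it.\<close>
proof (induction "3 ^ d + 1 - weight d (half (\<not> b) C)" arbitrary: C rule: less_induct)
  case less
  let ?u = "weight d (half b C)" and ?v = "weight d (half (\<not> b) C)"
  show ?case
  proof (cases "3 ^ d < ?v")
    case True
    then show ?thesis
      using less.prems(1) heavy_coverable coverable_halves by blast
  next
    case False
    \<comment> \<open>In the second alternative the pile of three is the exceptional vertex itself.
      Moving from it leaves all other piles at most 1, so the alternative survives the move.\<close>
    have "\<exists>x\<in>cube_verts d. 3 \<le> half b C x \<and>
      (3 * 3 ^ d + 4 \<le> ?u + 2 * ?v \<or>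
       3 * 3 ^ d + 3 \<le> ?u + 2 * ?v \<and> (\<forall>y\<in>cube_verts d. y \<noteq> x \<longrightarrow> half b C y \<le> 1))"
      using less.prems(2)
    proof
      assume *: "3 * 3 ^ d + 4 \<le> ?u + 2 * ?v"
      then have "3 * 2 ^ d < ?u"
        using False three_pow2_le_pow3[of d] by linarith
      then show ?thesis
        using * by (meson exists_pile_ge_3)
    next
      assume *: "3 * 3 ^ d + 3 \<le> ?u + 2 * ?v \<and>
        (\<exists>a. \<forall>x\<in>cube_verts d. x \<noteq> a \<longrightarrow> half b C x \<le> 1)"
      then have "2 * 2 ^ d + 1 < ?u"
        using False pow2_le_pow3[of d] by linarith
      then show ?thesis
        using * exists_pile_ge_3_single_stack by blast
    qed
    then obtain x where x: "x \<in> cube_verts d" "3 \<le> half b C x"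
      and pot: "3 * 3 ^ d + 4 \<le> ?u + 2 * ?v \<or>
       3 * 3 ^ d + 3 \<le> ?u + 2 * ?v \<and> (\<forall>y\<in>cube_verts d. y \<noteq> x \<longrightarrow> half b C y \<le> 1)"
      by blast
    let ?C = "cross b x C"
    have u: "?u = weight d (half b ?C) + 2"
      using weight_cross_source[OF x(1), of b C] x(2) by simp
    have v: "?v + 1 \<le> weight d (half (\<not> b) ?C)"
      using weight_cross_target[OF x(1), of b C] by simp
    have "\<forall>y\<in>cube_verts d. y \<noteq> x \<longrightarrow> half b ?C y \<le> 1"
      if "\<forall>y\<in>cube_verts d. y \<noteq> x \<longrightarrow> half b C y \<le> 1"
      using that by (simp add: half_cross)
    moreover have "?u + 2 * ?v \<le> weight d (half b ?C) + 2 * weight d (half (\<not> b) ?C)"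
      using u v by linarith
    ultimately have pot': "3 * 3 ^ d + 4 \<le> weight d (half b ?C) + 2 * weight d (half (\<not> b) ?C) \<or>
      3 * 3 ^ d + 3 \<le> weight d (half b ?C) + 2 * weight d (half (\<not> b) ?C) \<and>
      (\<exists>a. \<forall>x\<in>cube_verts d. x \<noteq> a \<longrightarrow> half b ?C x \<le> 1)"
      using pot by (meson le_trans)
    have "coverable (Suc d) ?C"
    proof (rule less.hyps[OF _ _ pot'])
      show "3 ^ d + 1 - weight d (half (\<not> b) ?C) < 3 ^ d + 1 - ?v"
        using False v by linarith
      \<comment> \<open>As \<open>?v\<close> is at most N, either alternative gives
        \<open>?u\<close> at least N + 3, so N + 1 remains after losing 2.\<close>
      show "3 ^ d < weight d (half b ?C)"
        using False u pot by linarith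
    qed
    then show ?thesis
      using coverable_cross[OF x(1), of b C] x(2) by simp
  qed
qed

lemma coverable_of_single_pebble:
  assumes "3 * 3 ^ d \<le> weight d (half b C) + 1" "weight d (half (\<not> b) C) = 2"
  shows "coverable (Suc d) C"
proof -
  have pos: "(1 :: nat) \<le> 3 ^ d"
    by simp
  obtain a where "a \<in> cube_verts d"
    and a: "\<And>x. x \<in> cube_verts d \<Longrightarrow> x \<noteq> a \<Longrightarrow> half (\<not> b) C x = 0"
    using weight_2_imp_single_support[OF assms(2)] by blast
  show ?thesis
  \<comment> \<open>If only \<open>a\<close> can carry a stack, the potential is at least (3N - 1) +
    4 = 3N + 3, enough for the second alternative. A stack elsewhere faces an empty vertex; moving
    from it yields at least (3N - 4) + 8 = 3N + 4.\<close>
  proof (cases "\<exists>x\<in>cube_verts d. x \<noteq> a \<and> 2 \<le> half b C x")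
    case False
    then have "\<forall>x\<in>cube_verts d. x \<noteq> a \<longrightarrow> half b C x \<le> 1"
      by force
    moreover have "3 * 3 ^ d + 3 \<le> weight d (half b C) + 2 * weight d (half (\<not> b) C)"
      using assms by simp
    moreover have "3 ^ d < weight d (half b C)"
      using assms pos by linarith
    ultimately show ?thesis
      using coverable_of_potential by blast
  next
    case True
    then obtain x where x: "x \<in> cube_verts d" "x \<noteq> a" "2 \<le> half b C x"
      by blast
    let ?C = "cross b x C"
    have u: "weight d (half b C) \<le> weight d (half b ?C) + 3"
      using weight_cross_source[OF x(1,3)] by simp
    have v: "weight d (half (\<not> b) ?C) = 4"
      using weight_cross_target[OF x(1), of b C] a[OF x(1,2)] assms(2) by simp
    show ?thesis
    \<comment> \<open>The heavy half must keep 3N - 4 > N, which fails for N = 1; but at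
      \<open>d = 0\<close> no vertex other than \<open>a\<close> exists.\<close>
    proof (cases d)
      case 0
      then show ?thesis
        using x \<open>a \<in> cube_verts d\<close> by (simp add: cube_verts_def)
    next
      case (Suc n)
      have "(1 :: nat) \<le> 3 ^ n"
        by simp
      then have "3 ^ d < weight d (half b ?C)"
        using u assms(1) unfolding Suc power_Suc by linarith
      then have "coverable (Suc d) ?C"
        using u v assms(1) by (intro coverable_of_potential[of b]) auto
      then show ?thesis
        using coverable_cross x by blast
    qed
  qed
qed

lemma heavy_coverable_Suc:
  assumes "3 ^ Suc d < weight (Suc d) C"
  shows "coverable (Suc d) C"
proof -
  have pos: "(1 :: nat) \<le> 3 ^ d"
    by simp
  obtain b where b: "weight d (half (\<not> b) C) \<le> weight d (half b C)"
    using linear[of "weight d (half True C)" "weight d (half False C)"] by (metis (full_types))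
  let ?u = "weight d (half b C)" and ?v = "weight d (half (\<not> b) C)"
  have sum: "3 * 3 ^ d < ?u + ?v"
    using assms weight_Suc[of d C b] by simp
  have u: "3 ^ d < ?u"
    using sum b pos by linarith
  \<comment> \<open>An occupied vertex contributes at least 2.\<close>
  have "?v \<noteq> 1"
  proof
    assume v: "?v = 1"
    then obtain x where x: "x \<in> cube_verts d" "half (\<not> b) C x \<noteq> 0"
      unfolding weight_def
      by (metis (mono_tags, lifting) pile_weight_def sum.neutral zero_neq_one)
    then have "pile_weight (half (\<not> b) C x) \<le> ?v"
      unfolding weight_def by (intro member_le_sum finite_cube_verts) auto
    then show False
      using v x by (simp add: pile_weight_def)
  qed
  then consider "?v = 0" | "?v = 2" | "3 \<le> ?v"
    by linarith
  then show ?thesis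
  proof cases
    case 1
    have "(2 :: nat) ^ d \<le> 3 ^ d"
      by (simp add: power_mono)
    then have "3 * 2 ^ d < ?u"
      using 1 sum by linarith
    then obtain x where x: "x \<in> cube_verts d" "3 \<le> half b C x"
      by (rule exists_pile_ge_3)
    have "half (\<not> b) C x = 0"
      using 1 x(1) by (simp add: weight_def finite_cube_verts pile_weight_def split: if_splits)
    then have "weight d (half (\<not> b) (cross b x C)) = 2"
      using weight_cross_target[OF x(1), of b C] 1 by simp
    \<comment> \<open>The heavy half weighs at least 3N + 1 and loses exactly 2, since the pile of
      three or more is not emptied.\<close>
    moreover have "3 * 3 ^ d \<le> weight d (half b (cross b x C)) + 1"
      using weight_cross_source[OF x(1), of b C] x(2) sum 1 by simp
    ultimately have "coverable (Suc d) (cross b x C)"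
      using coverable_of_single_pebble by blast
    then show ?thesis
      using coverable_cross[OF x(1), of b C] x(2) by simp
  next
    case 2
    then show ?thesis
      using sum by (intro coverable_of_single_pebble[of b]) auto
  next
    case 3
    \<comment> \<open>The potential is \<open>(?u + ?v) + ?v\<close>, at least (3N + 1) + 3.\<close>
    then show ?thesis
      using sum u by (intro coverable_of_potential[of b]) auto
  qed
qed

end

section \<open>Induction on the dimension and conclusion\<close>

lemma heavy_imp_coverable: "3 ^ d < weight d C \<Longrightarrow> coverable d C"
proof (induction d arbitrary: C)
  case 0
  have "cube_verts 0 = {[]}"
    by (auto simp: cube_verts_def)
  then show ?case
    using 0 by (auto simp: coverable_def weight_def pile_weight_def split: if_splits)
next
  case (Suc d)
  then show ?case
    using heavy_coverable_Suc by blast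
qed

theorem theorem3:
  fixes d :: nat and C :: config
  assumes "d > 0"
    and "int (config_size d C) \<ge> 3 ^ d - int (card (config_support d C)) + 1"
  shows "coverable d C"
proof (rule heavy_imp_coverable)
  have "int (3 ^ d) < int (weight d C)"
    using assms(2) by (simp add: weight_eq_size_plus_support)
  then show "3 ^ d < weight d C"
    by linarith
qed

end
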